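(* For the Web graph $\mathbb{W}_{n}$ with $n\ge 4$, the independent mixed metric number of $\mathbb{W}_{n}$ equals $n+1$.
   Context: For an integer $n\ge 3$, the Web graph $\mathbb{W}_{n}$ has vertex set $\{p_i,q_i,r_i : 1\le i\le n\}$ and edge set $\{p_iq_i,\ p_ip_{i+1},\ q_iq_{i+1},\ q_ir_i : 1\le i\le n\}$, with indices taken modulo $n$. For a connected graph $H$, $d_H(u,v)$ is the shortest-path distance, and for a vertex $x$ and an edge $e=uv$, $d_H(x,e)=\min\{d_H(x,u),d_H(x,v)\}$. A set $M\subseteq V(H)$ is a mixed metric generator of $H$ if for every two distinct elements $y_1,y_2\in V(H)\cup E(H)$ there is a vertex $z\in M$ with $d_H(z,y_1)\ne d_H(z,y_2)$. An independent mixed metric generator is a mixed metric generator that is an independent set (no two of its vertices are adjacent); the independent mixed metric number of $H$ is the minimum cardinality of an independent mixed metric generator of $H$. *)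

theory Defs
  imports "HOL-Library.Ramsey"
begin

text \<open>
  A finite simple graph is given by its vertex set \<open>V\<close> and its edge set \<open>E \<subseteq> [V]\<^bsup>2\<^esup>\<close>, the
  edges being two-element sets of vertices.
\<close>

definition simple_graph :: "'a set \<Rightarrow> 'a set set \<Rightarrow> bool" where
  "simple_graph V E \<longleftrightarrow> finite V \<and> E \<subseteq> [V]\<^bsup>2\<^esup>"

definition graph_path :: "'a set \<Rightarrow> 'a set set \<Rightarrow> 'a \<Rightarrow> 'a list \<Rightarrow> 'a \<Rightarrow> bool" where
  "graph_path V E u xs v \<longleftrightarrow>
     xs \<noteq> [] \<and> hd xs = u \<and> last xs = v \<and> set xs \<subseteq> V \<and> distinct xs \<and>
     successively (\<lambda>x y. {x, y} \<in> E) xs"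

definition graph_connected :: "'a set \<Rightarrow> 'a set set \<Rightarrow> bool" where
  "graph_connected V E \<longleftrightarrow> V \<noteq> {} \<and> (\<forall>u\<in>V. \<forall>v\<in>V. \<exists>xs. graph_path V E u xs v)"

text \<open>
  Paths are lists of vertices, so the length of a path is one less than that of its list. The
  distance is only meaningful between vertices of a connected graph.
\<close>

definition graph_dist :: "'a set \<Rightarrow> 'a set set \<Rightarrow> 'a \<Rightarrow> 'a \<Rightarrow> nat" where
  "graph_dist V E u v = (LEAST k. \<exists>xs. graph_path V E u xs v \<and> length xs = k + 1)"

definition edge_dist :: "'a set \<Rightarrow> 'a set set \<Rightarrow> 'a \<Rightarrow> 'a set \<Rightarrow> nat" where
  "edge_dist V E x e = Min (graph_dist V E x ` e)"

text \<open>
  The elements of \<open>V(H) \<union> E(H)\<close> are the members of the disjoint sum \<open>V <+> E\<close>: \<open>Inl v\<close> is the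
  vertex \<open>v\<close> and \<open>Inr e\<close> the edge \<open>e\<close>.
\<close>

definition mixed_dist :: "'a set \<Rightarrow> 'a set set \<Rightarrow> 'a \<Rightarrow> 'a + 'a set \<Rightarrow> nat" where
  "mixed_dist V E x y = (case y of Inl v \<Rightarrow> graph_dist V E x v | Inr e \<Rightarrow> edge_dist V E x e)"

definition mixed_metric_generator :: "'a set \<Rightarrow> 'a set set \<Rightarrow> 'a set \<Rightarrow> bool" where
  "mixed_metric_generator V E M \<longleftrightarrow>
     M \<subseteq> V \<and>
     (\<forall>y1 \<in> V <+> E. \<forall>y2 \<in> V <+> E. y1 \<noteq> y2 \<longrightarrow>
        (\<exists>z\<in>M. mixed_dist V E z y1 \<noteq> mixed_dist V E z y2))"

definition independent_mixed_metric_generator :: "'a set \<Rightarrow> 'a set set \<Rightarrow> 'a set \<Rightarrow> bool" where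
  "independent_mixed_metric_generator V E M \<longleftrightarrow> mixed_metric_generator V E M \<and> indep M E"

definition independent_mixed_metric_number :: "'a set \<Rightarrow> 'a set set \<Rightarrow> nat" where
  "independent_mixed_metric_number V E =
     (LEAST k. \<exists>M. independent_mixed_metric_generator V E M \<and> card M = k)"

datatype web_vertex = P nat | Q nat | R nat

definition web_vertices :: "nat \<Rightarrow> web_vertex set" where
  "web_vertices n = P ` {1..n} \<union> Q ` {1..n} \<union> R ` {1..n}"

text \<open>For \<open>1 \<le> i \<le> n\<close>, the index \<open>i + 1\<close> taken modulo \<open>n\<close> in \<open>{1..n}\<close> is \<open>i mod n + 1\<close>.\<close>

definition web_edges :: "nat \<Rightarrow> web_vertex set set" where
  "web_edges n =
     (\<Union>i\<in>{1..n}. {{P i, Q i}, {P i, P (i mod n + 1)}, {Q i, Q (i mod n + 1)}, {Q i, R i}})"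

lemma web_simple_graph:
  assumes "n \<ge> 3"
  shows "simple_graph (web_vertices n) (web_edges n)"
proof -
  have s: "i mod n + 1 \<in> {1..n}" "i mod n + 1 \<noteq> i" if "i \<in> {1..n}" for i
    using that assms by (cases "i = n"; force)+
  have "e \<in> [web_vertices n]\<^bsup>2\<^esup>" if "e \<in> web_edges n" for e
  proof -
    from that obtain i where i: "i \<in> {1..n}" and
      e: "e = {P i, Q i} \<or> e = {P i, P (i mod n + 1)} \<or> e = {Q i, Q (i mod n + 1)} \<or> e = {Q i, R i}"
      unfolding web_edges_def by blast
    then show ?thesis
      using s[OF i] unfolding nsets_def web_vertices_def by (auto simp: card_insert_if)
  qed
  then show ?thesis
    by (auto simp: simple_graph_def web_vertices_def)
qed

lemma graph_path_snoc:
  assumes p: "graph_path V E u xs v" and vw: "{v, w} \<in> E" "w \<in> V"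
  shows "\<exists>ys. graph_path V E u ys w"
proof (cases "w \<in> set xs")
  case True
  then obtain as bs where xs: "xs = as @ w # bs"
    by (meson split_list)
  have "graph_path V E u (as @ [w]) w"
    using p unfolding graph_path_def xs
    by (auto simp: successively_append_iff hd_append)
  then show ?thesis by blast
next
  case False
  then have "graph_path V E u (xs @ [w]) w"
    using p vw unfolding graph_path_def by (auto simp: successively_append_iff)
  then show ?thesis by blast
qed

lemma graph_connectedI:
  assumes V: "V \<noteq> {}" and VE: "\<And>x y. {x, y} \<in> E \<Longrightarrow> y \<in> V"
    and reach: "\<And>u v. u \<in> V \<Longrightarrow> v \<in> V \<Longrightarrow> (\<lambda>x y. {x, y} \<in> E)\<^sup>*\<^sup>* u v"
  shows "graph_connected V E"
proof -
  have "\<exists>xs. graph_path V E u xs v" if "u \<in> V" "v \<in> V" for u v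
    using reach[OF that]
  proof (induction rule: rtranclp_induct)
    case base
    have "graph_path V E u [u] u" using that by (simp add: graph_path_def)
    then show ?case by blast
  next
    case (step y z)
    then show ?case using graph_path_snoc[of V E u _ y z] VE by blast
  qed
  then show ?thesis using V by (simp add: graph_connected_def)
qed

lemma web_connected:
  assumes n: "n \<ge> 3"
  shows "graph_connected (web_vertices n) (web_edges n)"
proof (rule graph_connectedI)
  let ?r = "\<lambda>x y. {x, y} \<in> web_edges n"
  show "web_vertices n \<noteq> {}" using n by (auto simp: web_vertices_def)
  show "y \<in> web_vertices n" if "{x, y} \<in> web_edges n" for x y
    using that web_simple_graph[OF n] by (auto simp: simple_graph_def nsets_def)
  have sym: "?r\<^sup>*\<^sup>* v u" if "?r\<^sup>*\<^sup>* u v" for u v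
    using that
  proof (induction rule: rtranclp_induct)
    case base
    then show ?case by simp
  next
    case (step y z)
    then have "?r z y" by (simp add: insert_commute)
    then show ?case using step.IH by (rule converse_rtranclp_into_rtranclp)
  qed
  have PQ: "?r\<^sup>*\<^sup>* (Q i) (P i)" and RQ: "?r\<^sup>*\<^sup>* (R i) (Q i)" if "i \<in> {1..n}" for i
  proof -
    have "{P i, Q i} \<in> web_edges n" "{Q i, R i} \<in> web_edges n"
      using that unfolding web_edges_def by blast+
    then have "?r (Q i) (P i)" "?r (R i) (Q i)" by (simp_all add: insert_commute)
    then show "?r\<^sup>*\<^sup>* (Q i) (P i)" "?r\<^sup>*\<^sup>* (R i) (Q i)" by (simp_all add: r_into_rtranclp)
  qed
  have adj: "?r (P i) (P (Suc i))" if "1 \<le> i" "i < n" for i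
  proof -
    have "i mod n + 1 = Suc i" using that by simp
    then have "{P i, P (Suc i)} \<in> {{P i, Q i}, {P i, P (i mod n + 1)},
        {Q i, Q (i mod n + 1)}, {Q i, R i}}" by simp
    then show ?thesis using that unfolding web_edges_def
      by (intro UN_I[of i]) auto
  qed
  have P1: "?r\<^sup>*\<^sup>* (P 1) (P i)" if "1 \<le> i" "i \<le> n" for i
    using that
  proof (induction i rule: dec_induct)
    case base
    then show ?case by simp
  next
    case (step i)
    then show ?case using adj[of i]
      by (simp add: rtranclp.rtrancl_into_rtrancl)
  qed
  have to1: "?r\<^sup>*\<^sup>* u (P 1)" if "u \<in> web_vertices n" for u
  proof -
    from that obtain i where i: "i \<in> {1..n}" and u: "u = P i \<or> u = Q i \<or> u = R i"
      by (auto simp: web_vertices_def)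
    have p: "?r\<^sup>*\<^sup>* (P i) (P 1)" using i P1 sym by simp
    have q: "?r\<^sup>*\<^sup>* (Q i) (P 1)" using PQ[OF i] p by (rule rtranclp_trans)
    have r: "?r\<^sup>*\<^sup>* (R i) (P 1)" using RQ[OF i] q by (rule rtranclp_trans)
    show ?thesis using u p q r by blast
  qed
  show "?r\<^sup>*\<^sup>* u v" if "u \<in> web_vertices n" "v \<in> web_vertices n" for u v
    using to1[OF that(1)] sym[OF to1[OF that(2)]] by (rule rtranclp_trans)
qed

end

theory Submission
  imports Defs
begin

text \<open>
  A mixed metric generator contains every pendant vertex \<open>R\<^sub>i\<close>, since no other vertex separates
  \<open>Q\<^sub>i\<close> from the edge \<open>Q\<^sub>iR\<^sub>i\<close>, and at least one \<open>P\<^sub>j\<close>, since no \<open>Q\<^sub>j\<close> and no \<open>R\<^sub>j\<close> separates \<open>Q\<^sub>i\<close>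
  from the edge \<open>P\<^sub>iQ\<^sub>i\<close>. Conversely, all the \<open>R\<^sub>j\<close> together with \<open>P\<^sub>1\<close> suffice: the minimum over \<open>j\<close>
  of the distance from \<open>R\<^sub>j\<close> to an element, together with the set of those \<open>j\<close> that attain it,
  determines the element up to the pairs \<open>R\<^sub>i, Q\<^sub>iR\<^sub>i\<close> (separated by any other \<open>R\<^sub>j\<close>) and
  \<open>Q\<^sub>i, P\<^sub>iQ\<^sub>i\<close> (separated by \<open>P\<^sub>1\<close>).
\<close>

section \<open>Certifying distances by a potential function\<close>

text \<open>By \<open>lip\<close>, \<open>f\<close> grows by at most one along each edge, so no path
  from \<open>u\<close> to \<open>v\<close> has fewer than \<open>f v\<close> edges; following
  \<open>desc\<close> back from \<open>v\<close> yields a path of exactly that length. A distance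
  formula is thereby reduced to local checks.\<close>

lemma graph_dist_eqI:
  fixes f :: "'a \<Rightarrow> nat"
  assumes u: "u \<in> V" "f u = 0"
    and zero: "\<And>x. x \<in> V \<Longrightarrow> f x = 0 \<Longrightarrow> x = u"
    and lip: "\<And>x y. {x, y} \<in> E \<Longrightarrow> f y \<le> Suc (f x)"
    and desc: "\<And>x. x \<in> V \<Longrightarrow> f x > 0 \<Longrightarrow> \<exists>y\<in>V. {y, x} \<in> E \<and> f x = Suc (f y)"
    and v: "v \<in> V"
  shows "graph_dist V E u v = f v"
  unfolding graph_dist_def
proof (rule Least_equality)
  \<comment> \<open>The bound on \<open>f\<close> along the path is what keeps the list distinct:
    all earlier vertices have value at most \<open>f y < f v\<close>, so \<open>v\<close> is
    new.\<close>
  have "\<exists>xs. graph_path V E u xs v \<and> length xs = f v + 1 \<and> (\<forall>x\<in>set xs. f x \<le> f v)"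
    using v
  proof (induction "f v" arbitrary: v)
    case 0
    then have "v = u" using zero by simp
    then show ?case using u by (intro exI[of _ "[u]"]) (simp add: graph_path_def)
  next
    case (Suc k)
    then obtain y where y: "y \<in> V" "{y, v} \<in> E" "f v = Suc (f y)"
      using desc[of v] by auto
    with Suc obtain xs where xs: "graph_path V E u xs y" "length xs = f y + 1"
      "\<forall>x\<in>set xs. f x \<le> f y"
      by (metis nat.inject)
    then have "v \<notin> set xs" using y by force
    then have "graph_path V E u (xs @ [v]) v"
      using xs y Suc.prems by (auto simp: graph_path_def successively_append_iff)
    moreover have "\<forall>x\<in>set (xs @ [v]). f x \<le> f v" using xs y by auto
    ultimately show ?case using xs y by (intro exI[of _ "xs @ [v]"]) auto
  qed
  then show "\<exists>xs. graph_path V E u xs v \<and> length xs = f v + 1" by blast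
next
  fix k
  assume "\<exists>xs. graph_path V E u xs v \<and> length xs = k + 1"
  then obtain xs where xs: "graph_path V E u xs v" "length xs = k + 1" by blast
  have "f (last xs) + 1 \<le> f (hd xs) + length xs"
    if "xs \<noteq> []" "successively (\<lambda>x y. {x, y} \<in> E) xs" for xs
    using that
  proof (induction xs rule: induct_list012)
    case (3 x y zs)
    then show ?case using lip[of x y] by auto
  qed auto
  then show "f v \<le> k" using xs u by (force simp: graph_path_def)
qed

section \<open>Distance on the cycle\<close>

text \<open>The length of the shorter of the two arcs between \<open>i\<close> and \<open>j\<close>.
  The conditional plays the part of |i - j|, as subtraction on naturals truncates.\<close>

definition cyc_dist :: "nat \<Rightarrow> nat \<Rightarrow> nat \<Rightarrow> nat" where
  "cyc_dist n i j =
     min (if i \<le> j then j - i else i - j) (n - (if i \<le> j then j - i else i - j))"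

text \<open>A form of \<open>i mod n + 1\<close> free of \<open>mod\<close>, so that case splits and
  linear arithmetic suffice.\<close>

definition cyc_succ :: "nat \<Rightarrow> nat \<Rightarrow> nat" where
  "cyc_succ n i = (if i = n then 1 else i + 1)"

lemma mod_eq_cyc_succ: "i \<in> {1..n} \<Longrightarrow> i mod n + 1 = cyc_succ n i"
  by (auto simp: cyc_succ_def)

lemma cyc_succ_in: "i \<in> {1..n} \<Longrightarrow> cyc_succ n i \<in> {1..n}"
  by (auto simp: cyc_succ_def)

lemma cyc_succ_neq: "n \<ge> 2 \<Longrightarrow> cyc_succ n i \<noteq> i"
  by (auto simp: cyc_succ_def)

lemma cyc_succ_succ_neq: "n \<ge> 3 \<Longrightarrow> cyc_succ n (cyc_succ n i) \<noteq> i"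
  by (auto simp: cyc_succ_def)

lemma cyc_dist_eq_0_iff [simp]:
  "i \<in> {1..n} \<Longrightarrow> j \<in> {1..n} \<Longrightarrow> cyc_dist n i j = 0 \<longleftrightarrow> i = j"
  by (auto simp: cyc_dist_def min_def)

lemma cyc_dist_self [simp]: "cyc_dist n i i = 0"
  by (simp add: cyc_dist_def)

lemma cyc_dist_succ_le:
  assumes "i \<in> {1..n}" "j \<in> {1..n}"
  shows "cyc_dist n i (cyc_succ n j) \<le> Suc (cyc_dist n i j)"
    and "cyc_dist n i j \<le> Suc (cyc_dist n i (cyc_succ n j))"
  using assms by (auto simp: cyc_dist_def cyc_succ_def min_def)

lemma cyc_dist_descent:
  assumes "i \<in> {1..n}" "j \<in> {1..n}" "i \<noteq> j"
  obtains k where "k \<in> {1..n}" "k = cyc_succ n j \<or> j = cyc_succ n k"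
    "cyc_dist n i j = Suc (cyc_dist n i k)"
proof -
  define p where "p = (if j = 1 then n else j - 1)"
  have p: "p \<in> {1..n}" "j = cyc_succ n p"
    using assms by (auto simp: p_def cyc_succ_def)
  \<comment> \<open>The cases tell which arc from \<open>j\<close> to \<open>i\<close> is a shortest
    one, and so whether to step to the predecessor \<open>p\<close> or to the successor of
    \<open>j\<close>.\<close>
  consider "i < j" "2 * (j - i) \<le> n" | "i < j" "2 * (j - i) > n"
    | "j < i" "2 * (i - j) \<le> n" | "j < i" "2 * (i - j) > n"
    using assms(3) by linarith
  then show ?thesis
  proof cases
    case 1
    then have "cyc_dist n i j = Suc (cyc_dist n i p)"
      using assms by (cases j) (auto simp: cyc_dist_def p_def)
    with p that show ?thesis by blast
  next
    case 2
    then have "cyc_dist n i j = Suc (cyc_dist n i (cyc_succ n j))"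
      using assms by (cases "j = n") (simp_all add: cyc_dist_def cyc_succ_def)
    with that cyc_succ_in[OF assms(2)] show ?thesis by blast
  next
    case 3
    then have "cyc_dist n i j = Suc (cyc_dist n i (cyc_succ n j))"
      using assms by (auto simp: cyc_dist_def cyc_succ_def)
    with that cyc_succ_in[OF assms(2)] show ?thesis by blast
  next
    case 4
    then have "cyc_dist n i j = Suc (cyc_dist n i p)"
      using assms by (cases "j = 1") (auto simp: cyc_dist_def p_def)
    with p that show ?thesis by blast
  qed
qed

section \<open>Distances in the Web graph\<close>

text \<open>The distance around the cycle plus the number of steps between layers. Two distinct
  pendant vertices cost two such steps, which is why \<open>R i\<close> to itself is a separate
  case.\<close>

fun web_dist :: "nat \<Rightarrow> web_vertex \<Rightarrow> web_vertex \<Rightarrow> nat" where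
  "web_dist n (P i) (P j) = cyc_dist n i j"
| "web_dist n (P i) (Q j) = cyc_dist n i j + 1"
| "web_dist n (P i) (R j) = cyc_dist n i j + 2"
| "web_dist n (Q i) (P j) = cyc_dist n i j + 1"
| "web_dist n (Q i) (Q j) = cyc_dist n i j"
| "web_dist n (Q i) (R j) = cyc_dist n i j + 1"
| "web_dist n (R i) (P j) = cyc_dist n i j + 2"
| "web_dist n (R i) (Q j) = cyc_dist n i j + 1"
| "web_dist n (R i) (R j) = (if i = j then 0 else cyc_dist n i j + 2)"

lemma web_vertices_cases:
  assumes "v \<in> web_vertices n"
  obtains i where "i \<in> {1..n}" "v = P i" | i where "i \<in> {1..n}" "v = Q i"
    | i where "i \<in> {1..n}" "v = R i"
  using assms by (auto simp: web_vertices_def)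

lemma in_web_vertices [simp]:
  "P i \<in> web_vertices n \<longleftrightarrow> i \<in> {1..n}"
  "Q i \<in> web_vertices n \<longleftrightarrow> i \<in> {1..n}"
  "R i \<in> web_vertices n \<longleftrightarrow> i \<in> {1..n}"
  by (auto simp: web_vertices_def)

lemma web_edges_cases:
  assumes "e \<in> web_edges n"
  obtains i where "i \<in> {1..n}" "e = {P i, Q i}"
    | i where "i \<in> {1..n}" "e = {P i, P (cyc_succ n i)}"
    | i where "i \<in> {1..n}" "e = {Q i, Q (cyc_succ n i)}"
    | i where "i \<in> {1..n}" "e = {Q i, R i}"
  using assms unfolding web_edges_def UN_iff
  by (elim bexE, subst (asm) (1 2) mod_eq_cyc_succ) blast+

lemma in_web_edges:
  assumes "i \<in> {1..n}"
  shows "{P i, Q i} \<in> web_edges n" "{Q i, P i} \<in> web_edges n"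
    and "{Q i, R i} \<in> web_edges n" "{R i, Q i} \<in> web_edges n"
    and "{P i, P (cyc_succ n i)} \<in> web_edges n" "{P (cyc_succ n i), P i} \<in> web_edges n"
    and "{Q i, Q (cyc_succ n i)} \<in> web_edges n" "{Q (cyc_succ n i), Q i} \<in> web_edges n"
proof -
  show "{P i, Q i} \<in> web_edges n" "{Q i, R i} \<in> web_edges n"
    "{P i, P (cyc_succ n i)} \<in> web_edges n" "{Q i, Q (cyc_succ n i)} \<in> web_edges n"
    using assms unfolding web_edges_def mod_eq_cyc_succ[OF assms, symmetric] by blast+
  then show "{Q i, P i} \<in> web_edges n" "{R i, Q i} \<in> web_edges n"
    "{P (cyc_succ n i), P i} \<in> web_edges n" "{Q (cyc_succ n i), Q i} \<in> web_edges n"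
    by (simp_all add: insert_commute)
qed

lemma web_dist_lipschitz:
  assumes "u \<in> web_vertices n" "{x, y} \<in> web_edges n"
  shows "web_dist n u y \<le> Suc (web_dist n u x)"
  using assms(2)
proof (cases rule: web_edges_cases)
  case (1 i)
  with assms(1) show ?thesis
    by (auto simp: doubleton_eq_iff elim!: web_vertices_cases)
next
  case (2 i)
  with assms(1) show ?thesis
    by (auto simp: doubleton_eq_iff cyc_dist_succ_le elim!: web_vertices_cases)
next
  case (3 i)
  with assms(1) show ?thesis
    by (auto simp: doubleton_eq_iff cyc_dist_succ_le elim!: web_vertices_cases)
next
  case (4 i)
  with assms(1) show ?thesis
    by (auto simp: doubleton_eq_iff elim!: web_vertices_cases)
qed

lemma web_dist_eq_0:
  assumes "u \<in> web_vertices n" "v \<in> web_vertices n" "web_dist n u v = 0"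
  shows "v = u"
  using assms by (auto elim!: web_vertices_cases split: if_splits)

lemma web_dist_descent:
  assumes "u \<in> web_vertices n" "x \<in> web_vertices n" "web_dist n u x > 0"
  shows "\<exists>y\<in>web_vertices n. {y, x} \<in> web_edges n \<and> web_dist n u x = Suc (web_dist n u y)"
proof -
  obtain i where i: "i \<in> {1..n}" "u = P i \<or> u = Q i \<or> u = R i"
    using assms(1) by (elim web_vertices_cases) auto
  obtain j where j: "j \<in> {1..n}" "x = P j \<or> x = Q j \<or> x = R j"
    using assms(2) by (elim web_vertices_cases) auto
  \<comment> \<open>The step from \<open>x\<close> towards \<open>u\<close> changes layer first,
    counting \<open>R i\<close> with the \<open>Q\<close> cycle; once the layers agree it follows
    the cycle, and a last step goes from \<open>Q i\<close> to \<open>R i\<close>. From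
    \<open>R j\<close> the only way out is \<open>Q j\<close>.\<close>
  consider "x = P j" "u = Q i \<or> u = R i" | "x = Q j" "u = P i" | "x = R j" |
      "i \<noteq> j" "x = P j" "u = P i" | "i \<noteq> j" "x = Q j" "u = Q i \<or> u = R i" |
      "i = j" "x = Q j" "u = R i"
    using i j assms(3) by force
  then show ?thesis
  proof cases
    case 1
    then show ?thesis using i j in_web_edges[OF j(1)] by (intro bexI[of _ "Q j"]) auto
  next
    case 2
    then show ?thesis using i j in_web_edges[OF j(1)] by (intro bexI[of _ "P j"]) auto
  next
    case 3
    then show ?thesis using i j in_web_edges[OF j(1)] assms(3)
      by (intro bexI[of _ "Q j"]) (auto split: if_splits)
  next
    case 4
    obtain k where "k \<in> {1..n}" "k = cyc_succ n j \<or> j = cyc_succ n k"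
      "cyc_dist n i j = Suc (cyc_dist n i k)"
      using cyc_dist_descent i j 4 by metis
    with 4 show ?thesis using in_web_edges[OF j(1)] in_web_edges[of k n]
      by (intro bexI[of _ "P k"]) auto
  next
    case 5
    obtain k where "k \<in> {1..n}" "k = cyc_succ n j \<or> j = cyc_succ n k"
      "cyc_dist n i j = Suc (cyc_dist n i k)"
      using cyc_dist_descent i j 5 by metis
    with 5 show ?thesis using in_web_edges[OF j(1)] in_web_edges[of k n]
      by (intro bexI[of _ "Q k"]) auto
  next
    case 6
    then show ?thesis using i j in_web_edges[OF j(1)] by (intro bexI[of _ "R j"]) auto
  qed
qed

lemma graph_dist_web:
  assumes "u \<in> web_vertices n" "v \<in> web_vertices n"
  shows "graph_dist (web_vertices n) (web_edges n) u v = web_dist n u v"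
proof (rule graph_dist_eqI[OF assms(1)])
  show "web_dist n u u = 0" by (cases u) auto
qed (use assms web_dist_eq_0 web_dist_lipschitz web_dist_descent in blast)+

lemma mixed_dist_web_vertex:
  assumes "z \<in> web_vertices n" "v \<in> web_vertices n"
  shows "mixed_dist (web_vertices n) (web_edges n) z (Inl v) = web_dist n z v"
  using assms by (simp add: mixed_dist_def graph_dist_web)

lemma mixed_dist_web_edge:
  assumes "z \<in> web_vertices n" "u \<in> web_vertices n" "v \<in> web_vertices n"
  shows "mixed_dist (web_vertices n) (web_edges n) z (Inr {u, v}) =
    min (web_dist n z u) (web_dist n z v)"
  using assms by (simp add: mixed_dist_def edge_dist_def graph_dist_web)

section \<open>The lower bound\<close>

lemma web_generator_contains_R:
  assumes M: "mixed_metric_generator (web_vertices n) (web_edges n) M" and i: "i \<in> {1..n}"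
  shows "R i \<in> M"
proof -
  have "Inl (Q i) \<in> web_vertices n <+> web_edges n"
    "Inr {Q i, R i} \<in> web_vertices n <+> web_edges n"
    using i in_web_edges by auto
  then obtain z where z: "z \<in> M" "z \<in> web_vertices n"
    "mixed_dist (web_vertices n) (web_edges n) z (Inl (Q i)) \<noteq>
     mixed_dist (web_vertices n) (web_edges n) z (Inr {Q i, R i})"
    using M unfolding mixed_metric_generator_def by blast
  \<comment> \<open>The distance to an edge is a minimum over its ends, so it differs from that to
    \<open>Q i\<close> only if \<open>R i\<close> is strictly closer.\<close>
  then have "web_dist n z (R i) < web_dist n z (Q i)"
    using i by (simp add: mixed_dist_web_vertex mixed_dist_web_edge min_def split: if_splits)
  then have "z = R i" by (cases z) (auto split: if_splits)
  with z show ?thesis by simp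
qed

lemma web_generator_contains_P:
  assumes M: "mixed_metric_generator (web_vertices n) (web_edges n) M" and n: "n \<ge> 1"
  obtains j where "P j \<in> M"
proof -
  have "Inl (Q 1) \<in> web_vertices n <+> web_edges n"
    "Inr {P 1, Q 1} \<in> web_vertices n <+> web_edges n"
    using n in_web_edges[of 1 n] by auto
  then obtain z where z: "z \<in> M" "z \<in> web_vertices n"
    "mixed_dist (web_vertices n) (web_edges n) z (Inl (Q 1)) \<noteq>
     mixed_dist (web_vertices n) (web_edges n) z (Inr {P 1, Q 1})"
    using M unfolding mixed_metric_generator_def by blast
  then have "web_dist n z (P 1) < web_dist n z (Q 1)"
    using n by (simp add: mixed_dist_web_vertex mixed_dist_web_edge min_def split: if_splits)
  then obtain j where "z = P j" by (cases z) auto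
  with z that show ?thesis by simp
qed

lemma web_generator_card_ge:
  assumes M: "mixed_metric_generator (web_vertices n) (web_edges n) M" and n: "n \<ge> 1"
  shows "n + 1 \<le> card M"
proof -
  obtain j where j: "P j \<in> M" using web_generator_contains_P[OF M n] .
  have "finite (web_vertices n)" by (simp add: web_vertices_def)
  then have "finite M"
    using M by (auto simp: mixed_metric_generator_def intro: finite_subset)
  moreover have "insert (P j) (R ` {1..n}) \<subseteq> M"
    using j web_generator_contains_R[OF M] by auto
  ultimately have "card (insert (P j) (R ` {1..n})) \<le> card M" by (rule card_mono)
  moreover have "card (R ` {1..n}) = n" by (subst card_image) (auto simp: inj_on_def)
  moreover have "P j \<notin> R ` {1..n}" by auto
  ultimately show ?thesis by simp
qed

section \<open>The upper bound: minima and where they are attained\<close>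

text \<open>Nonemptiness of \<open>S\<close> makes \<open>m\<close> a value of \<open>f\<close>, so
  \<open>f\<close> on \<open>{1..n}\<close> determines both \<open>m\<close> and
  \<open>S\<close>.\<close>

definition min_attained_at :: "nat \<Rightarrow> (nat \<Rightarrow> nat) \<Rightarrow> nat \<Rightarrow> nat set \<Rightarrow> bool" where
  "min_attained_at n f m S \<longleftrightarrow>
     S \<noteq> {} \<and> S \<subseteq> {1..n} \<and> (\<forall>j\<in>{1..n}. m \<le> f j \<and> (f j = m \<longleftrightarrow> j \<in> S))"

lemma min_attained_at_unique:
  assumes "min_attained_at n f m S" "min_attained_at n g m' S'" "\<And>j. j \<in> {1..n} \<Longrightarrow> f j = g j"
  shows "m = m'" "S = S'"
proof -
  obtain i k where "i \<in> S" "k \<in> S'" "i \<in> {1..n}" "k \<in> {1..n}"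
    using assms(1,2) unfolding min_attained_at_def by blast
  then have "f i = m" "m' \<le> f i" "f k = m'" "m \<le> f k"
    using assms unfolding min_attained_at_def by auto
  then show "m = m'" by simp
  then have "j \<in> S \<longleftrightarrow> j \<in> S'" if "j \<in> {1..n}" for j
    using that assms unfolding min_attained_at_def by auto
  then show "S = S'"
    using assms(1,2) unfolding min_attained_at_def by blast
qed

text \<open>The table of the distance to the nearest pendant vertices and of their indices. It is a
  relation because edges are sets and admit no pattern matching.\<close>

inductive web_signature :: "nat \<Rightarrow> web_vertex + web_vertex set \<Rightarrow> nat \<Rightarrow> nat set \<Rightarrow> bool" for n where
  "i \<in> {1..n} \<Longrightarrow> web_signature n (Inl (R i)) 0 {i}"
| "i \<in> {1..n} \<Longrightarrow> web_signature n (Inr {Q i, R i}) 0 {i}"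
| "i \<in> {1..n} \<Longrightarrow> web_signature n (Inl (Q i)) 1 {i}"
| "i \<in> {1..n} \<Longrightarrow> web_signature n (Inr {P i, Q i}) 1 {i}"
| "i \<in> {1..n} \<Longrightarrow> web_signature n (Inr {Q i, Q (cyc_succ n i)}) 1 {i, cyc_succ n i}"
| "i \<in> {1..n} \<Longrightarrow> web_signature n (Inl (P i)) 2 {i}"
| "i \<in> {1..n} \<Longrightarrow> web_signature n (Inr {P i, P (cyc_succ n i)}) 2 {i, cyc_succ n i}"

lemma web_signature_exists:
  assumes "y \<in> web_vertices n <+> web_edges n"
  obtains m S where "web_signature n y m S"
  using assms
  by (elim PlusE web_vertices_cases web_edges_cases) (blast intro: web_signature.intros)+

lemma web_signature_min_attained:
  assumes "web_signature n y m S"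
  shows "min_attained_at n (\<lambda>j. mixed_dist (web_vertices n) (web_edges n) (R j) y) m S"
  using assms
proof cases
qed (use cyc_succ_in[of _ n] in
  \<open>force simp: min_attained_at_def mixed_dist_web_vertex mixed_dist_web_edge min_def\<close>)+

lemma web_signature_collisions:
  assumes n: "n \<ge> 3" and "web_signature n y m S" "web_signature n y' m S" "y \<noteq> y'"
  obtains i where "i \<in> {1..n}" "{y, y'} = {Inl (R i), Inr {Q i, R i}}"
    | i where "i \<in> {1..n}" "{y, y'} = {Inl (Q i), Inr {P i, Q i}}"
proof -
  \<comment> \<open>The first inequality separates \<open>{i}\<close> from the two-element sets; the
    second makes \<open>{i, cyc_succ n i}\<close> determine \<open>i\<close>.\<close>
  have "cyc_succ n i \<noteq> i" "cyc_succ n (cyc_succ n i) \<noteq> i" for i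
    using n cyc_succ_neq cyc_succ_succ_neq by simp_all
  then have "(\<exists>i\<in>{1..n}. {y, y'} = {Inl (R i), Inr {Q i, R i}}) \<or>
      (\<exists>i\<in>{1..n}. {y, y'} = {Inl (Q i), Inr {P i, Q i}})"
    using assms(2-4) by (elim web_signature.cases) (auto simp: doubleton_eq_iff)
  with that show thesis by blast
qed

lemma web_R_P_generator:
  assumes n: "n \<ge> 3"
  shows "mixed_metric_generator (web_vertices n) (web_edges n) (insert (P 1) (R ` {1..n}))"
proof -
  let ?M = "insert (P 1) (R ` {1..n})"
  let ?d = "mixed_dist (web_vertices n) (web_edges n)"
  have "\<exists>z\<in>?M. ?d z y \<noteq> ?d z y'"
    if y: "y \<in> web_vertices n <+> web_edges n" "y' \<in> web_vertices n <+> web_edges n" "y \<noteq> y'"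
    for y y'
  proof (rule ccontr)
    assume "\<not> ?thesis"
    then have eq: "?d z y = ?d z y'" if "z \<in> ?M" for z using that by blast
    obtain m S where s: "web_signature n y m S" using web_signature_exists[OF y(1)] .
    obtain m' S' where s': "web_signature n y' m' S'" using web_signature_exists[OF y(2)] .
    have "m = m'" "S = S'"
      using min_attained_at_unique[OF web_signature_min_attained[OF s]
          web_signature_min_attained[OF s']] eq by auto
    with s' have "web_signature n y' m S" by simp
    from n s this y(3) show False
    proof (cases rule: web_signature_collisions)
      case (1 i)
      have j: "cyc_succ n i \<in> {1..n}" "cyc_succ n i \<noteq> i"
        using cyc_succ_in[OF 1(1)] cyc_succ_neq n by auto
      \<comment> \<open>The successor serves as an index other than \<open>i\<close>: its pendant
        vertex reaches the edge at \<open>Q i\<close>, one step before \<open>R i\<close>.\<close>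
      have "?d (R (cyc_succ n i)) (Inl (R i)) = ?d (R (cyc_succ n i)) (Inr {Q i, R i})"
        using eq[of "R (cyc_succ n i)"] j 1(2) by (auto simp: doubleton_eq_iff)
      then show False
        using 1(1) j by (simp add: mixed_dist_web_vertex mixed_dist_web_edge)
    next
      case (2 i)
      \<comment> \<open>From \<open>P 1\<close> the edge is met at \<open>P i\<close>, one step
        before \<open>Q i\<close>.\<close>
      have "?d (P 1) (Inl (Q i)) = ?d (P 1) (Inr {P i, Q i})"
        using eq[of "P 1"] 2(2) by (auto simp: doubleton_eq_iff)
      then show False
        using 2(1) n by (simp add: mixed_dist_web_vertex mixed_dist_web_edge)
    qed
  qed
  then show ?thesis using n by (auto simp: mixed_metric_generator_def)
qed

text \<open>The only neighbour of \<open>R j\<close> is \<open>Q j\<close>, which lies outside the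
  set.\<close>

lemma web_R_P_indep: "indep (insert (P 1) (R ` {1..n})) (web_edges n)"
  by (auto simp: indep_def doubleton_eq_iff elim!: web_edges_cases)

theorem theorem8:
  fixes n :: nat
  assumes "n \<ge> 4"
  shows "independent_mixed_metric_number (web_vertices n) (web_edges n) = n + 1"
  unfolding independent_mixed_metric_number_def
proof (rule Least_equality)
  have "card (R ` {1..n}) = n" by (subst card_image) (auto simp: inj_on_def)
  moreover have "P 1 \<notin> R ` {1..n}" by auto
  ultimately have "card (insert (P 1) (R ` {1..n})) = n + 1" by simp
  then show "\<exists>M. independent_mixed_metric_generator (web_vertices n) (web_edges n) M \<and>
      card M = n + 1"
    using assms web_R_P_generator[of n] web_R_P_indep[of n]
    by (auto simp: independent_mixed_metric_generator_def)
next
  fix k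
  assume "\<exists>M. independent_mixed_metric_generator (web_vertices n) (web_edges n) M \<and> card M = k"
  then show "n + 1 \<le> k"
    using assms web_generator_card_ge[of n]
    by (auto simp: independent_mixed_metric_generator_def)
qed

end
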